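(* The set $\mathbb{T}(8,2)=\{(8x+2y,\,y) : x,y\in\mathbb{Z}\}$ is a $(4,5)$ broadcast on $G_\infty$, and its broadcast density is strictly lower than the broadcast density of $\mathbb{T}(5,3)=\{(5x+3y,\,y) : x,y\in\mathbb{Z}\}$, which is an optimal $(2,1)$ broadcast on $G_\infty$. Consequently, it is false that $\delta_{t,r}(G_\infty)=\delta_{t+1,r+2}(G_\infty)$ for all integers $t,r\geq 1$.
   Context: $G_\infty$ is the infinite grid graph with vertex set $\mathbb{Z}\times\mathbb{Z}$, where two vertices are adjacent if and only if they are at Euclidean distance $1$; $dist(u,v)$ is the length of a shortest path between $u$ and $v$ in $G_\infty$ (that is, the $\ell^1$ distance). For a positive integer $t$, the signal that a vertex $v$ receives from a tower of strength $t$ located at a vertex $T$ is $sig(v,T)=\max(t-dist(v,T),0)$. For positive integers $t$ and $r$, a set $S\subseteq\mathbb{Z}\times\mathbb{Z}$ is a $(t,r)$ broadcast (also called a $(t,r)$ broadcast dominating set) on $G_\infty$ if, with a tower of strength $t$ placed at each element of $S$, the total signal $\sum_{T\in S} sig(v,T)$ is at least $r$ for every vertex $v$. The broadcast density of a $(t,r)$ broadcast $S$ is $\lim_{n\to\infty}\frac{|S\cap V_n|}{|V_n|}$, where $V_n=\{-n,\dots,n\}\times\{-n,\dots,n\}$ is the vertex set of the $(2n+1)\times(2n+1)$ grid centered at $(0,0)$. The optimal density $\delta_{t,r}(G_\infty)$ is the minimum broadcast density over all $(t,r)$ broadcasts on $G_\infty$, and a $(t,r)$ broadcast is optimal if its density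 equals $\delta_{t,r}(G_\infty)$. *)

theory Defs
  imports "HOL-Analysis.Analysis" "Graph_Theory.Pair_Digraph"
begin

type_synonym vertex = "int \<times> int"

definition real_point :: "vertex \<Rightarrow> real \<times> real" where
  "real_point v = (real_of_int (fst v), real_of_int (snd v))"

text \<open>
  The infinite grid as a symmetric digraph: each edge is a pair of opposite arcs.
  The metric on the product type is the Euclidean one.
\<close>

definition grid :: "vertex pair_pre_digraph" where
  "grid = \<lparr> pverts = UNIV, parcs = {(u, v). dist (real_point u) (real_point v) = 1} \<rparr>"

text \<open>Paths are lists of arcs, so the length of the list is the number of edges.\<close>

definition grid_dist :: "vertex \<Rightarrow> vertex \<Rightarrow> nat" where
  "grid_dist u v = (LEAST k. \<exists>p. pre_digraph.apath (with_proj grid) u p v \<and> length p = k)"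

definition sig :: "nat \<Rightarrow> vertex \<Rightarrow> vertex \<Rightarrow> real" where
  "sig t v T = max (real t - real (grid_dist v T)) 0"

text \<open>
  For each \<open>v\<close> only finitely many towers contribute a nonzero signal, so the
  unordered sum is always a finite one, even for infinite \<open>S\<close>.
\<close>

definition is_broadcast :: "nat \<Rightarrow> nat \<Rightarrow> vertex set \<Rightarrow> bool" where
  "is_broadcast t r S \<longleftrightarrow> (\<forall>v. (\<Sum>\<^sub>\<infinity>T\<in>S. sig t v T) \<ge> real r)"

definition box :: "nat \<Rightarrow> vertex set" where
  "box n = {- int n..int n} \<times> {- int n..int n}"

definition box_ratio :: "vertex set \<Rightarrow> nat \<Rightarrow> real" where
  "box_ratio S n = real (card (S \<inter> box n)) / real (card (box n))"

text \<open>The density is meaningful only when the limit exists.\<close>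

definition has_density :: "vertex set \<Rightarrow> bool" where
  "has_density S \<longleftrightarrow> convergent (box_ratio S)"

definition broadcast_density :: "vertex set \<Rightarrow> real" where
  "broadcast_density S = lim (box_ratio S)"

definition broadcast_densities :: "nat \<Rightarrow> nat \<Rightarrow> real set" where
  "broadcast_densities t r = {broadcast_density S | S. is_broadcast t r S \<and> has_density S}"

text \<open>
  \<open>Inf\<close> is the minimum whenever a minimum exists (\<open>optimal_density_eq_minimum\<close>); it is
  unspecified when there is no \<open>(t, r)\<close> broadcast with a density at all, as for
  \<open>t = 1\<close> and \<open>r = 2\<close>.
\<close>

definition optimal_density :: "nat \<Rightarrow> nat \<Rightarrow> real" where
  "optimal_density t r = Inf (broadcast_densities t r)"

definition is_optimal_broadcast :: "nat \<Rightarrow> nat \<Rightarrow> vertex set \<Rightarrow> bool" where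
  "is_optimal_broadcast t r S \<longleftrightarrow>
     is_broadcast t r S \<and> has_density S \<and> broadcast_density S = optimal_density t r"

definition tower_lattice :: "int \<Rightarrow> int \<Rightarrow> vertex set" where
  "tower_lattice d e = {(d * x + e * y, y) | x y. True}"


lemma optimal_density_eq_minimum:
  assumes "d \<in> broadcast_densities t r" "\<And>d'. d' \<in> broadcast_densities t r \<Longrightarrow> d \<le> d'"
  shows "optimal_density t r = d"
  unfolding optimal_density_def using assms by (rule cInf_eq_minimum)

lemma broadcast_densities_nonneg:
  assumes "d \<in> broadcast_densities t r"
  shows "0 \<le> d"
proof -
  obtain S where S: "has_density S" "d = broadcast_density S"
    using assms by (auto simp: broadcast_densities_def)
  have "box_ratio S \<longlonglongrightarrow> d"
    using S by (simp add: has_density_def broadcast_density_def convergent_LIMSEQ_iff)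
  then show ?thesis
    by (rule LIMSEQ_le_const) (auto simp: box_ratio_def)
qed

lemma is_optimal_broadcast_iff_minimal:
  "is_optimal_broadcast t r S \<longleftrightarrow>
     is_broadcast t r S \<and> has_density S \<and>
     (\<forall>S'. is_broadcast t r S' \<and> has_density S' \<longrightarrow> broadcast_density S \<le> broadcast_density S')"
    (is "?L \<longleftrightarrow> ?R")
proof
  have bdd: "bdd_below (broadcast_densities t r)"
    using broadcast_densities_nonneg by (rule bdd_belowI)
  assume ?L
  then show ?R
    using cInf_lower[OF _ bdd]
    by (auto simp: is_optimal_broadcast_def optimal_density_def broadcast_densities_def)
next
  assume R: ?R
  then have "optimal_density t r = broadcast_density S"
    by (intro optimal_density_eq_minimum) (auto simp: broadcast_densities_def)
  with R show ?L
    by (simp add: is_optimal_broadcast_def)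
qed

lemma pverts_grid: "pverts grid = UNIV"
  by (simp add: grid_def)

lemma grid_adjacent_iff:
  "(u, v) \<in> parcs grid \<longleftrightarrow> \<bar>fst u - fst v\<bar> + \<bar>snd u - snd v\<bar> = 1"
proof -
  define a b where "a = fst u - fst v" and "b = snd u - snd v"
  have "(u, v) \<in> parcs grid \<longleftrightarrow> sqrt (real_of_int (a\<^sup>2 + b\<^sup>2)) = 1"
    by (simp add: grid_def real_point_def dist_Pair_Pair dist_real_def a_def b_def)
  also have "\<dots> \<longleftrightarrow> a\<^sup>2 + b\<^sup>2 = 1"
    by (simp del: of_int_add of_int_power)
  also have "\<dots> \<longleftrightarrow> \<bar>a\<bar> + \<bar>b\<bar> = 1"
  proof
    assume h: "a\<^sup>2 + b\<^sup>2 = 1"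
    have *: "\<bar>a\<bar> \<le> a\<^sup>2" "\<bar>b\<bar> \<le> b\<^sup>2"
      by (metis abs_ge_zero abs_le_square_iff power2_abs power2_eq_square mult_le_cancel_left1
          int_one_le_iff_zero_less linorder_not_le mult.commute order_antisym_conv order_refl)+
    have "a \<noteq> 0 \<or> b \<noteq> 0" using h by auto
    then show "\<bar>a\<bar> + \<bar>b\<bar> = 1" using * h by linarith
  next
    assume "\<bar>a\<bar> + \<bar>b\<bar> = 1"
    then have "(\<bar>a\<bar> = 0 \<and> \<bar>b\<bar> = 1) \<or> (\<bar>a\<bar> = 1 \<and> \<bar>b\<bar> = 0)" by linarith
    then show "a\<^sup>2 + b\<^sup>2 = 1"
      by (metis power2_abs add_0 add_0_right one_power2 zero_power2)
  qed
  finally show ?thesis by (simp add: a_def b_def)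
qed

lemma grid_dist_eq: "int (grid_dist u v) = \<bar>fst u - fst v\<bar> + \<bar>snd u - snd v\<bar>"
proof -
  interpret pair_wf_digraph grid
    by unfold_locales (auto simp: grid_def)
  have lower: "\<bar>fst u - fst v\<bar> + \<bar>snd u - snd v\<bar> \<le> int (length p)" if "awalk u p v" for u p v
    using that
  proof (induction p arbitrary: u)
    case Nil
    then show ?case by (simp add: awalk_Nil_iff)
  next
    case (Cons e p)
    then have e: "(u, snd e) \<in> parcs grid" and w: "awalk (snd e) p v"
      by (auto simp: awalk_Cons_iff)
    show ?case
      using Cons.IH[OF w] e unfolding grid_adjacent_iff by simp
  qed
  have upper: "\<exists>p. apath u p v \<and> length p = n \<and>
      (\<forall>x\<in>set (awalk_verts u p). \<bar>fst x - fst v\<bar> + \<bar>snd x - snd v\<bar> \<le> int n)"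
    if "\<bar>fst u - fst v\<bar> + \<bar>snd u - snd v\<bar> = int n" for u v n
    using that
  proof (induction n arbitrary: u)
    case 0
    then have "fst u = fst v" "snd u = snd v" by linarith+
    then have "u = v" by (simp add: prod_eq_iff)
    then have "apath u [] v" by (simp add: apath_Nil_iff pverts_grid)
    then show ?case using \<open>u = v\<close> by (intro exI[of _ "[]"]) simp
  next
    case (Suc n)
    define w where "w = (if fst u < fst v then (fst u + 1, snd u)
      else if fst v < fst u then (fst u - 1, snd u)
      else if snd u < snd v then (fst u, snd u + 1) else (fst u, snd u - 1))"
    have uw: "(u, w) \<in> parcs grid"
      by (simp add: grid_adjacent_iff w_def)
    have "\<bar>fst w - fst v\<bar> + \<bar>snd w - snd v\<bar> = int n"
      using Suc.prems by (auto simp: w_def)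
    then obtain p where p: "apath w p v" "length p = n"
      "\<forall>x\<in>set (awalk_verts w p). \<bar>fst x - fst v\<bar> + \<bar>snd x - snd v\<bar> \<le> int n"
      using Suc.IH by blast
    have "u \<notin> set (awalk_verts w p)"
      using p(3) Suc.prems by fastforce
    then have "apath u ((u, w) # p) v"
      using uw p(1) by (simp add: apath_Cons_iff)
    then show ?case
      using p(2,3) Suc.prems by (intro exI[of _ "(u, w) # p"]) fastforce
  qed
  define n where "n = nat (\<bar>fst u - fst v\<bar> + \<bar>snd u - snd v\<bar>)"
  have n: "\<bar>fst u - fst v\<bar> + \<bar>snd u - snd v\<bar> = int n"
    by (simp add: n_def)
  have least: "n \<le> length p" if "apath u p v" for p
    using lower[OF awalkI_apath[OF that]] n by simp
  have "grid_dist u v = n"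
    unfolding grid_dist_def
    by (rule Least_equality) (use upper[OF n] least in auto)
  then show ?thesis using n by simp
qed

end

theory Submission
  imports Defs "HOL-Real_Asymp.Real_Asymp"
begin

text \<open>
  Membership of a point in \<open>tower_lattice d e\<close> is a congruence modulo \<open>d\<close> in each row. Two things
  follow. Each row of the box of width \<open>2 n + 1\<close> holds \<open>(2 n + 1) / d\<close> towers up to an error of
  at most 1, so the lattice has density \<open>1 / d\<close> (\<open>box_ratio_tower_lattice\<close>). And whether a vertex
  \<open>(a, b)\<close> receives enough signal depends only on the residue of \<open>a - e * b\<close>, so that a finite table
  with one set of nearby towers for each residue proves the broadcast property
  (\<open>is_broadcast_tower_lattice\<close>). For \<open>(d, e) = (8, 2)\<close> and strength 4, the residues receive
  signal 6 or 5 alternately.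

  A tower of strength 2 reaches just the five vertices of a plus shape. The pluses around the towers
  in a slightly larger box have to cover the box, and so every \<open>(2, 1)\<close> broadcast with a density has
  density at least \<open>1 / 5\<close> (\<open>broadcast_density_2_1\<close>). The lattice with \<open>d = 5\<close> attains this bound.

  If the optimal densities for \<open>(t, r)\<close> and \<open>(t + 1, r + 2)\<close> always agreed, two steps
  \<open>(2, 1)\<close>, \<open>(3, 3)\<close>, \<open>(4, 5)\<close> would give \<open>1 / 5 = optimal_density 4 5 \<le> 1 / 8\<close>. So one of these
  two steps fails; the argument does not tell which one.
\<close>

section \<open>Density of a tower lattice\<close>

lemma mem_tower_lattice_iff: "(a, b) \<in> tower_lattice d e \<longleftrightarrow> d dvd a - e * b"
  by (auto simp: tower_lattice_def dvd_def algebra_simps)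

lemma card_box: "real (card (box n)) = (2 * real n + 1)\<^sup>2"
proof -
  have "card {- int n..int n} = 2 * n + 1" by simp
  then show ?thesis
    by (simp add: box_def card_cartesian_product power2_eq_square algebra_simps)
qed

lemma finite_box [simp]: "finite (box n)"
  by (simp add: box_def)

text \<open>
  The elements of the residue class of \<open>c\<close> are the numbers \<open>d * k + c\<close>, and the admissible \<open>k\<close> fill an
  interval bounded by two quotients, each of which loses less than 1 to rounding.
\<close>

lemma card_residue_class_interval:
  fixes a b c d :: int
  assumes "d > 0" "a \<le> b"
  shows "\<bar>real (card {x \<in> {a<..b}. d dvd x - c}) - (b - a) / d\<bar> \<le> 1"
proof -
  let ?p = "(a - c) div d" and ?q = "(b - c) div d"
  have bounds: "a < d * k + c \<longleftrightarrow> ?p < k" "d * k + c \<le> b \<longleftrightarrow> k \<le> ?q" for k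
  proof -
    have le: "k \<le> z div d \<longleftrightarrow> d * k \<le> z" for z
      using le_floor_iff[of k "real_of_int z / real_of_int d"] assms(1)
      by (simp add: floor_divide_of_int_eq pos_le_divide_eq mult.commute flip: of_int_mult)
    show "a < d * k + c \<longleftrightarrow> ?p < k" "d * k + c \<le> b \<longleftrightarrow> k \<le> ?q"
      using le[of "a - c"] le[of "b - c"] by linarith+
  qed
  have "{x \<in> {a<..b}. d dvd x - c} = (\<lambda>k. d * k + c) ` {?p<..?q}"
  proof (intro equalityI subsetI)
    fix x assume "x \<in> {x \<in> {a<..b}. d dvd x - c}"
    then obtain k where "x = d * k + c" "a < x" "x \<le> b"
      by (auto simp: dvd_def) (metis diff_add_cancel)
    then show "x \<in> (\<lambda>k. d * k + c) ` {?p<..?q}"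
      using bounds by auto
  qed (use bounds in auto)
  moreover have "inj_on (\<lambda>k. d * k + c) {?p<..?q}"
    using assms(1) by (auto simp: inj_on_def)
  ultimately have "card {x \<in> {a<..b}. d dvd x - c} = nat (?q - ?p)"
    by (simp add: card_image)
  moreover have "?p \<le> ?q" using assms by (intro zdiv_mono1) auto
  ultimately have "real (card {x \<in> {a<..b}. d dvd x - c}) = real_of_int ?q - real_of_int ?p"
    by simp
  moreover have "real_of_int (z div d) \<le> z / d" "z / d < real_of_int (z div d) + 1" for z
    using floor_divide_of_int_eq[of z d, where ?'a = real]
    by linarith+
  note this[of "a - c"] this[of "b - c"]
  moreover have "(b - a) / d = (b - c) / d - (a - c) / d"
    by (simp add: diff_divide_distrib)
  ultimately show ?thesis by linarith
qed

lemma box_ratio_tower_lattice: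
  assumes "d > 0"
  shows "box_ratio (tower_lattice d e) \<longlonglongrightarrow> 1 / real_of_int d"
proof -
  have "\<bar>box_ratio (tower_lattice d e) n - 1 / d\<bar> \<le> 1 / (2 * real n + 1)" for n
  proof -
    let ?row = "\<lambda>y. {x \<in> {- int n - 1<..int n}. d dvd x - e * y}"
    let ?m = "2 * real n + 1"
    have "bij_betw prod.swap (SIGMA y : {- int n..int n}. ?row y) (tower_lattice d e \<inter> box n)"
      by (rule bij_betwI[where g = prod.swap]) (auto simp: box_def mem_tower_lattice_iff)
    then have "card (tower_lattice d e \<inter> box n) = card (SIGMA y : {- int n..int n}. ?row y)"
      by (simp add: bij_betw_same_card)
    also have "\<dots> = (\<Sum>y = - int n..int n. card (?row y))"
      by (rule card_SigmaI) (auto intro: finite_subset[OF _ finite_greaterThanAtMost_int])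
    finally have "real (card (tower_lattice d e \<inter> box n))
        = (\<Sum>y = - int n..int n. real (card (?row y)))"
      by (simp only: of_nat_sum)
    moreover have "(\<Sum>y = - int n..int n. ?m / d) = ?m\<^sup>2 / d"
      by (simp add: power2_eq_square)
    ultimately have "real (card (tower_lattice d e \<inter> box n)) - ?m\<^sup>2 / d
        = (\<Sum>y = - int n..int n. real (card (?row y)) - ?m / d)"
      by (simp only: sum_subtractf)
    also have "\<bar>\<dots>\<bar> \<le> (\<Sum>y = - int n..int n. \<bar>real (card (?row y)) - ?m / d\<bar>)"
      by (rule sum_abs)
    also have "\<dots> \<le> (\<Sum>y = - int n..int n. 1)"
    proof (rule sum_mono)
      fix y
      have "real_of_int (int n - (- int n - 1)) = ?m" by simp
      then show "\<bar>real (card (?row y)) - ?m / d\<bar> \<le> 1"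
        using card_residue_class_interval[OF assms, of "- int n - 1" "int n" "e * y"] by simp
    qed
    also have "\<dots> = ?m" by simp
    finally have "\<bar>real (card (tower_lattice d e \<inter> box n)) - ?m\<^sup>2 / d\<bar> \<le> ?m" .
    then have "\<bar>real (card (tower_lattice d e \<inter> box n)) - ?m\<^sup>2 / d\<bar> / ?m\<^sup>2 \<le> ?m / ?m\<^sup>2"
      by (rule divide_right_mono) simp
    also have "?m / ?m\<^sup>2 = 1 / ?m"
      by (simp add: power2_eq_square)
    also have "\<bar>real (card (tower_lattice d e \<inter> box n)) - ?m\<^sup>2 / d\<bar> / ?m\<^sup>2
        = \<bar>(real (card (tower_lattice d e \<inter> box n)) - ?m\<^sup>2 / d) / ?m\<^sup>2\<bar>"
      by (simp only: abs_divide abs_power2)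
    also have "(real (card (tower_lattice d e \<inter> box n)) - ?m\<^sup>2 / d) / ?m\<^sup>2
        = box_ratio (tower_lattice d e) n - 1 / d"
    proof -
      have "?m\<^sup>2 \<noteq> 0" by (simp add: add_nonneg_eq_0_iff)
      then show ?thesis unfolding box_ratio_def card_box diff_divide_distrib by simp
    qed
    finally show ?thesis .
  qed
  moreover have "(\<lambda>n. 1 / (2 * real n + 1)) \<longlonglongrightarrow> 0"
    by real_asymp
  ultimately have "(\<lambda>n. box_ratio (tower_lattice d e) n - 1 / d) \<longlonglongrightarrow> 0"
    using Lim_null_comparison[OF always_eventually,
        of "\<lambda>n. box_ratio (tower_lattice d e) n - 1 / d" "\<lambda>n. 1 / (2 * real n + 1)"]
    by (simp only: real_norm_def simp_thms)
  then show ?thesis by (rule LIM_zero_cancel)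
qed

corollary has_density_tower_lattice: "d > 0 \<Longrightarrow> has_density (tower_lattice d e)"
  using box_ratio_tower_lattice by (auto simp: has_density_def convergent_def)

corollary broadcast_density_tower_lattice:
  "d > 0 \<Longrightarrow> broadcast_density (tower_lattice d e) = 1 / real_of_int d"
  using box_ratio_tower_lattice by (auto simp: broadcast_density_def limI)


section \<open>Checking broadcasts locally\<close>

lemma sig_eq: "sig t (a, b) (x, y) = max (real t - real_of_int (\<bar>a - x\<bar> + \<bar>b - y\<bar>)) 0"
proof -
  have "real (grid_dist (a, b) (x, y)) = real_of_int (int (grid_dist (a, b) (x, y)))"
    by (rule of_int_of_nat_eq[symmetric])
  then show ?thesis by (simp only: sig_def grid_dist_eq fst_conv snd_conv)
qed

text \<open>
  The total signal is an unordered sum, which would be 0 by default if it did not converge; it does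
  converge because only the towers in a bounded neighbourhood of the vertex contribute.
\<close>

lemma sig_summable_on: "sig t v summable_on S"
proof -
  obtain a b where v: "v = (a, b)" by force
  let ?N = "{a - int t..a + int t} \<times> {b - int t..b + int t}"
  have "sig t v summable_on (S \<inter> ?N)" by (rule summable_on_finite) auto
  moreover have "sig t v T = 0" if "T \<notin> ?N" for T
  proof -
    obtain x y where T: "T = (x, y)" by force
    with that have "int t \<le> \<bar>a - x\<bar> + \<bar>b - y\<bar>" by auto
    then have "real t \<le> real_of_int (\<bar>a - x\<bar> + \<bar>b - y\<bar>)"
      by (metis of_int_le_iff of_int_of_nat_eq)
    then show ?thesis by (simp add: v T sig_eq)
  qed
  ultimately show ?thesis
    by (subst summable_on_cong_neutral[of "S \<inter> ?N" S _ "sig t v"]) auto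
qed

lemma sum_sig_le_total_signal:
  assumes "finite F" "F \<subseteq> S"
  shows "sum (sig t v) F \<le> (\<Sum>\<^sub>\<infinity>T\<in>S. sig t v T)"
  by (rule finite_sum_le_infsum[OF sig_summable_on assms]) (simp add: sig_def)

text \<open>
  The vertices \<open>(a, b)\<close> with a fixed residue of \<open>a - e * b\<close> are translates of each other by vectors
  of the lattice, so they see the same configuration of towers. The set \<open>D c\<close> lists displacements
  from towers to such a vertex; listing only some of the towers in range still gives a lower bound.
\<close>

lemma is_broadcast_tower_lattice:
  fixes D :: "int \<Rightarrow> (int \<times> int) set"
  assumes "d > 0"
    and D: "\<And>c. 0 \<le> c \<Longrightarrow> c < d \<Longrightarrow> finite (D c) \<and> (\<forall>(x, y)\<in>D c. (x - e * y) mod d = c) \<and>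
      real r \<le> (\<Sum>(x, y)\<in>D c. max (real t - real_of_int (\<bar>x\<bar> + \<bar>y\<bar>)) 0)"
  shows "is_broadcast t r (tower_lattice d e)"
  unfolding is_broadcast_def
proof
  fix v :: vertex
  obtain a b where v: "v = (a, b)" by force
  define c where "c = (a - e * b) mod d"
  let ?f = "\<lambda>(x, y). (a - x, b - y)"
  have c: "0 \<le> c" "c < d" using assms(1) by (auto simp: c_def)
  have inj: "inj_on ?f (D c)" by (auto simp: inj_on_def)
  have "?f ` D c \<subseteq> tower_lattice d e"
  proof clarify
    fix x y assume "(x, y) \<in> D c"
    then have "(a - e * b) mod d = (x - e * y) mod d" using D[OF c] by (auto simp: c_def)
    then have "d dvd (a - e * b) - (x - e * y)" by (simp add: mod_eq_dvd_iff)
    then show "(a - x, b - y) \<in> tower_lattice d e"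
      by (simp add: mem_tower_lattice_iff algebra_simps)
  qed
  then have "sum (sig t v) (?f ` D c) \<le> (\<Sum>\<^sub>\<infinity>T\<in>tower_lattice d e. sig t v T)"
    using D[OF c] by (intro sum_sig_le_total_signal) auto
  moreover have "sum (sig t v) (?f ` D c) = (\<Sum>(x, y)\<in>D c. max (real t - real_of_int (\<bar>x\<bar> + \<bar>y\<bar>)) 0)"
    unfolding sum.reindex[OF inj] by (intro sum.cong) (auto simp: v sig_eq)
  ultimately show "real r \<le> (\<Sum>\<^sub>\<infinity>T\<in>tower_lattice d e. sig t v T)"
    using D[OF c] by linarith
qed

lemma is_broadcast_4_5: "is_broadcast 4 5 (tower_lattice 8 2)"
proof -
  define D :: "int \<Rightarrow> (int \<times> int) set" where "D c =
    (if c = 0 then {(0, 0), (2, 1), (-2, -1)}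
     else if c = 1 then {(1, 0), (-1, -1)}
     else if c = 2 then {(2, 0), (0, -1)}
     else if c = 3 then {(3, 0), (1, -1), (-1, -2), (-1, 2)}
     else if c = 4 then {(2, -1), (-2, 1), (0, -2), (0, 2)}
     else if c = 5 then {(-3, 0), (-1, 1), (1, 2), (1, -2)}
     else if c = 6 then {(-2, 0), (0, 1)}
     else {(-1, 0), (1, 1)})" for c
  show ?thesis
  proof (rule is_broadcast_tower_lattice[where D = D])
    fix c :: int assume "0 \<le> c" "c < 8"
    then have "c = 0 \<or> c = 1 \<or> c = 2 \<or> c = 3 \<or> c = 4 \<or> c = 5 \<or> c = 6 \<or> c = 7" by linarith
    then show "finite (D c) \<and> (\<forall>(x, y)\<in>D c. (x - 2 * y) mod 8 = c) \<and>
        real 5 \<le> (\<Sum>(x, y)\<in>D c. max (real 4 - real_of_int (\<bar>x\<bar> + \<bar>y\<bar>)) 0)"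
      by (elim disjE) (simp_all add: D_def)
  qed simp
qed

lemma is_broadcast_2_1: "is_broadcast 2 1 (tower_lattice 5 3)"
proof -
  define D :: "int \<Rightarrow> (int \<times> int) set" where "D c =
    (if c = 0 then {(0, 0)} else if c = 1 then {(1, 0)} else if c = 2 then {(0, 1)}
     else if c = 3 then {(0, -1)} else {(-1, 0)})" for c
  show ?thesis
  proof (rule is_broadcast_tower_lattice[where D = D])
    fix c :: int assume "0 \<le> c" "c < 5"
    then have "c = 0 \<or> c = 1 \<or> c = 2 \<or> c = 3 \<or> c = 4" by linarith
    then show "finite (D c) \<and> (\<forall>(x, y)\<in>D c. (x - 3 * y) mod 5 = c) \<and>
        real 1 \<le> (\<Sum>(x, y)\<in>D c. max (real 2 - real_of_int (\<bar>x\<bar> + \<bar>y\<bar>)) 0)"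
      by (elim disjE) (simp_all add: D_def)
  qed simp
qed

text \<open>
  A tower on every vertex witnesses that \<open>(3, 3)\<close> broadcasts with a density exist, which is what the
  intermediate step from \<open>(2, 1)\<close> to \<open>(4, 5)\<close> needs.
\<close>

lemma is_broadcast_every_vertex: "is_broadcast t r (tower_lattice 1 0)" if "r \<le> t"
  using that by (intro is_broadcast_tower_lattice[where D = "\<lambda>_. {(0, 0)}"]) auto


section \<open>A lower bound for (2, 1) broadcasts\<close>

lemma broadcast_2_1_dominates:
  assumes "is_broadcast 2 1 S"
  obtains x y where "(x, y) \<in> S" "\<bar>a - x\<bar> + \<bar>b - y\<bar> \<le> 1"
proof -
  have "\<exists>T\<in>S. sig 2 (a, b) T \<noteq> 0"
  proof (rule ccontr)
    assume "\<not> ?thesis"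
    then have "(\<Sum>\<^sub>\<infinity>T\<in>S. sig 2 (a, b) T) = 0" by (intro infsum_0) auto
    moreover have "1 \<le> (\<Sum>\<^sub>\<infinity>T\<in>S. sig 2 (a, b) T)"
      using assms by (simp add: is_broadcast_def)
    ultimately show False by simp
  qed
  then obtain x y where xy: "(x, y) \<in> S" "sig 2 (a, b) (x, y) \<noteq> 0" by auto
  then have "real_of_int (\<bar>a - x\<bar> + \<bar>b - y\<bar>) < of_int 2"
    unfolding sig_eq by (simp split: if_splits add: max_def)
  then have "\<bar>a - x\<bar> + \<bar>b - y\<bar> < 2" by (subst (asm) of_int_less_iff)
  with xy(1) show ?thesis by (intro that) auto
qed

text \<open>
  A tower may dominate a vertex of the box from just outside, hence the larger box on the right.
\<close>

lemma card_box_le_broadcast_2_1: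
  assumes "is_broadcast 2 1 S"
  shows "card (box n) \<le> 5 * card (S \<inter> box (Suc n))"
proof -
  let ?plus = "{(0, 0), (1, 0), (-1, 0), (0, 1), (0, -1)} :: vertex set"
  let ?f = "\<lambda>(T :: vertex, u :: vertex). (fst T + fst u, snd T + snd u)"
  have "box n \<subseteq> ?f ` ((S \<inter> box (Suc n)) \<times> ?plus)"
  proof clarify
    fix a b assume ab: "(a, b) \<in> box n"
    obtain x y where xy: "(x, y) \<in> S" "\<bar>a - x\<bar> + \<bar>b - y\<bar> \<le> 1"
      using broadcast_2_1_dominates[OF assms] by metis
    have "(x, y) \<in> S \<inter> box (Suc n)" using xy ab by (auto simp: box_def)
    moreover have "(a - x, b - y) \<in> ?plus" using xy(2) by auto
    ultimately show "(a, b) \<in> ?f ` ((S \<inter> box (Suc n)) \<times> ?plus)"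
      by (intro image_eqI[of _ _ "((x, y), (a - x, b - y))"]) auto
  qed
  then have "card (box n) \<le> card ((S \<inter> box (Suc n)) \<times> ?plus)"
    by (intro surj_card_le) auto
  also have "\<dots> = 5 * card (S \<inter> box (Suc n))"
    by (simp add: card_cartesian_product)
  finally show ?thesis .
qed

lemma broadcast_density_2_1:
  assumes "is_broadcast 2 1 S" "has_density S"
  shows "1 / 5 \<le> broadcast_density S"
proof (rule LIMSEQ_le)
  show "(\<lambda>n. (2 * real n + 1)\<^sup>2 / (2 * real n + 3)\<^sup>2 / 5) \<longlonglongrightarrow> 1 / 5"
    by real_asymp
  have "box_ratio S \<longlonglongrightarrow> broadcast_density S"
    using assms(2) by (simp add: has_density_def broadcast_density_def convergent_LIMSEQ_iff)
  then show "(\<lambda>n. box_ratio S (Suc n)) \<longlonglongrightarrow> broadcast_density S"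
    by (rule LIMSEQ_Suc)
  have "(2 * real n + 1)\<^sup>2 / (2 * real n + 3)\<^sup>2 / 5 \<le> box_ratio S (Suc n)" for n
  proof -
    have "real (card (box n)) \<le> real (5 * card (S \<inter> box (Suc n)))"
      using card_box_le_broadcast_2_1[OF assms(1)] by (rule of_nat_mono)
    then have "(2 * real n + 1)\<^sup>2 / 5 \<le> real (card (S \<inter> box (Suc n)))"
      by (simp add: card_box)
    then have "(2 * real n + 1)\<^sup>2 / 5 / (2 * real n + 3)\<^sup>2
        \<le> real (card (S \<inter> box (Suc n))) / (2 * real n + 3)\<^sup>2"
      by (rule divide_right_mono) simp
    moreover have "real (card (box (Suc n))) = (2 * real n + 3)\<^sup>2"
      by (simp add: card_box algebra_simps)
    ultimately show ?thesis by (simp add: box_ratio_def mult.commute)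
  qed
  then show "\<exists>N. \<forall>n\<ge>N. (2 * real n + 1)\<^sup>2 / (2 * real n + 3)\<^sup>2 / 5 \<le> box_ratio S (Suc n)"
    by blast
qed


section \<open>The counterexample\<close>

theorem mainTheorem1:
  shows "is_broadcast 4 5 (tower_lattice 8 2)
    \<and> has_density (tower_lattice 8 2)
    \<and> broadcast_density (tower_lattice 8 2) < broadcast_density (tower_lattice 5 3)
    \<and> is_optimal_broadcast 2 1 (tower_lattice 5 3)
    \<and> \<not> (\<forall>t r :: nat. t \<ge> 1 \<longrightarrow> r \<ge> 1
          \<longrightarrow> broadcast_densities t r \<noteq> {} \<longrightarrow> broadcast_densities (t + 1) (r + 2) \<noteq> {}
          \<longrightarrow> optimal_density t r = optimal_density (t + 1) (r + 2))"
proof (intro conjI)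
  show optimal: "is_optimal_broadcast 2 1 (tower_lattice 5 3)"
    unfolding is_optimal_broadcast_iff_minimal
    using is_broadcast_2_1 broadcast_density_2_1
    by (simp add: has_density_tower_lattice broadcast_density_tower_lattice del: One_nat_def)
  have d21: "1 / 5 \<in> broadcast_densities 2 1"
    using is_broadcast_2_1 has_density_tower_lattice[of 5 3] broadcast_density_tower_lattice[of 5 3]
    by (force simp: broadcast_densities_def)
  have d33: "1 \<in> broadcast_densities 3 3"
    using is_broadcast_every_vertex[of 3 3] has_density_tower_lattice[of 1 0]
      broadcast_density_tower_lattice[of 1 0]
    by (force simp: broadcast_densities_def)
  have d45: "1 / 8 \<in> broadcast_densities 4 5"
    using is_broadcast_4_5 has_density_tower_lattice[of 8 2] broadcast_density_tower_lattice[of 8 2]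
    by (force simp: broadcast_densities_def)
  have "optimal_density 4 5 \<le> 1 / 8"
    unfolding optimal_density_def
    using d45 broadcast_densities_nonneg by (intro cInf_lower bdd_belowI) auto
  moreover have "optimal_density 2 1 = 1 / 5"
    using optimal by (simp add: is_optimal_broadcast_def broadcast_density_tower_lattice)
  ultimately have "optimal_density 2 1 \<noteq> optimal_density 4 5" by linarith
  show "\<not> (\<forall>t r :: nat. t \<ge> 1 \<longrightarrow> r \<ge> 1
      \<longrightarrow> broadcast_densities t r \<noteq> {} \<longrightarrow> broadcast_densities (t + 1) (r + 2) \<noteq> {}
      \<longrightarrow> optimal_density t r = optimal_density (t + 1) (r + 2))" (is "\<not> ?invariant")
  proof
    assume ?invariant
    note step = this[rule_format]
    have "optimal_density 2 1 = optimal_density 3 3"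
      using step[of 2 1] d21 d33 by (auto simp: numeral_eq_Suc)
    moreover have "optimal_density 3 3 = optimal_density 4 5"
      using step[of 3 3] d33 d45 by auto
    ultimately show False
      using \<open>optimal_density 2 1 \<noteq> optimal_density 4 5\<close> by simp
  qed
qed (simp_all add: is_broadcast_4_5 has_density_tower_lattice broadcast_density_tower_lattice)

end
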